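(* Let $k$ and $n$ be positive integers, $p$ a rational prime, $H\in\operatorname{BH}(n,k)$, and let $\mathbf{x}$ be $H$-bent. Suppose $k_p=1$ (i.e. $p\nmid k$), $n_p>1$ (i.e. $p\mid n$), and $p$ is self-conjugate modulo $k$. Then $n_p$ is a perfect square.
   Context: $\zeta_k=e^{2\pi\sqrt{-1}/k}$, $\langle\zeta_k\rangle$ is the set of $k$-th roots of unity. $\operatorname{BH}(n,k)$ is the set of $n\times n$ matrices $H$ with entries in $\langle\zeta_k\rangle$ with $HH^*=nI_n$. A vector $\mathbf{x}\in\langle\zeta_k\rangle^n$ is $H$-bent if $H\mathbf{x}=\sqrt{n}\,\mathbf{y}$ with every entry of $\mathbf{y}$ a complex number of modulus $1$. For a nonzero integer $m$ and prime $p$, $m_p$ denotes the highest power of $p$ dividing $m$. A prime $p$ is self-conjugate modulo $k$ if there exists an integer $j\ge 0$ with $p^j\equiv -1 \pmod{k/k_p}$. *)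

theory Defs
  imports
    Complex_Main
    "HOL-Computational_Algebra.Nth_Powers"
    "HOL-Number_Theory.Cong"
    "Jordan_Normal_Form.Schur_Decomposition"
begin

definition roots_of_unity :: "nat \<Rightarrow> complex set" where
  "roots_of_unity k = {z. z ^ k = 1}"

text \<open>Butson Hadamard matrices; \<^term>\<open>mat_adjoint\<close> is the conjugate transpose.\<close>

definition BH :: "nat \<Rightarrow> nat \<Rightarrow> complex mat set" where
  "BH n k = {H \<in> carrier_mat n n.
     (\<forall>i<n. \<forall>j<n. H $$ (i, j) \<in> roots_of_unity k) \<and>
     H * mat_adjoint H = of_nat n \<cdot>\<^sub>m 1\<^sub>m n}"

definition bent :: "nat \<Rightarrow> nat \<Rightarrow> complex mat \<Rightarrow> complex vec \<Rightarrow> bool" where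
  "bent n k H x \<longleftrightarrow>
     x \<in> carrier_vec n \<and> (\<forall>i<n. x $ i \<in> roots_of_unity k) \<and>
     (\<exists>y \<in> carrier_vec n. (\<forall>i<n. cmod (y $ i) = 1) \<and>
        H *\<^sub>v x = complex_of_real (sqrt (real n)) \<cdot>\<^sub>v y)"

text \<open>\<open>prime_part p m\<close> is the number written \<open>m\<^sub>p\<close>: the power of \<open>p\<close> itself, not its exponent.\<close>

definition prime_part :: "nat \<Rightarrow> nat \<Rightarrow> nat" where
  "prime_part p m = p ^ multiplicity p m"

definition self_conjugate :: "nat \<Rightarrow> nat \<Rightarrow> bool" where
  "self_conjugate p k \<longleftrightarrow>
     (\<exists>j::nat. [int p ^ j = - 1] (mod int (k div prime_part p k)))"

end

theory Submission
  imports Defs "HOL-Number_Theory.Residues"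
begin

text \<open>An entry \<open>a\<close> of \<open>H x\<close> lies in \<open>\<int>[\<zeta>\<^sub>k]\<close> and satisfies \<open>a * cnj a = n\<close>. Choose \<open>j > 0\<close> with
  \<open>p ^ j \<equiv> -1\<close> modulo \<open>k\<close>; then \<open>a ^ (p ^ j) \<equiv> cnj a\<close> modulo \<open>p\<close>, because the \<open>p ^ j\<close>-th power is additive
  modulo \<open>p\<close> and inverts roots of unity. Hence \<open>p\<close> divides \<open>a\<close> as soon as it divides the
  integer \<open>a * cnj a\<close>, so dividing \<open>a\<close> by \<open>p\<close> repeatedly removes the prime \<open>p\<close> from \<open>n\<close> in pairs.\<close>

section \<open>Arithmetic of the ring of integer combinations of roots of unity\<close>

text \<open>This is \<open>\<int>[\<zeta>]\<close> for a primitive \<open>k\<close>-th root of unity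
  \<open>\<zeta>\<close>, generated as an additive group. Adding or subtracting one root at a time
  gives an induction in which additive claims reduce to a single root.\<close>

inductive_set cyclotomic_ints :: "nat \<Rightarrow> complex set" for k where
  zero: "0 \<in> cyclotomic_ints k"
| add_root: "\<lbrakk>a \<in> cyclotomic_ints k; z \<in> roots_of_unity k\<rbrakk> \<Longrightarrow> a + z \<in> cyclotomic_ints k"
| diff_root: "\<lbrakk>a \<in> cyclotomic_ints k; z \<in> roots_of_unity k\<rbrakk> \<Longrightarrow> a - z \<in> cyclotomic_ints k"

lemma one_in_roots_of_unity: "1 \<in> roots_of_unity k"
  by (simp add: roots_of_unity_def)

lemma mult_roots_of_unity:
  "w \<in> roots_of_unity k \<Longrightarrow> z \<in> roots_of_unity k \<Longrightarrow> w * z \<in> roots_of_unity k"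
  by (simp add: roots_of_unity_def power_mult_distrib)

lemma roots_of_unity_mult_cnj:
  assumes "z \<in> roots_of_unity k" "k > 0"
  shows "z * cnj z = 1"
proof -
  have "cmod z ^ k = 1"
    using assms(1) by (metis (mono_tags) mem_Collect_eq norm_one norm_power roots_of_unity_def)
  then have "cmod z = 1"
    using assms(2) power_eq_1_iff[of "cmod z" k] by auto
  then show ?thesis
    by (simp add: complex_norm_square[symmetric])
qed

lemma cnj_roots_of_unity: "z \<in> roots_of_unity k \<Longrightarrow> cnj z \<in> roots_of_unity k"
  by (simp add: roots_of_unity_def flip: complex_cnj_power)

lemma roots_of_unity_subset: "roots_of_unity k \<subseteq> cyclotomic_ints k"
  using cyclotomic_ints.add_root[OF cyclotomic_ints.zero] by auto

lemma cyclotomic_ints_add: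
  assumes "a \<in> cyclotomic_ints k" "b \<in> cyclotomic_ints k"
  shows "a + b \<in> cyclotomic_ints k"
  using assms(2,1)
  by induction (auto simp: add.assoc[symmetric] add_diff_eq intro: cyclotomic_ints.intros)

lemma cyclotomic_ints_uminus:
  assumes "a \<in> cyclotomic_ints k"
  shows "- a \<in> cyclotomic_ints k"
  using assms
proof induction
  case (add_root a z)
  then show ?case using cyclotomic_ints.diff_root[of "-a" k z] by simp
next
  case (diff_root a z)
  then show ?case using cyclotomic_ints.add_root[of "-a" k z] by (simp add: add.commute)
qed (simp add: cyclotomic_ints.zero)

lemma cyclotomic_ints_diff:
  "a \<in> cyclotomic_ints k \<Longrightarrow> b \<in> cyclotomic_ints k \<Longrightarrow> a - b \<in> cyclotomic_ints k"
  using cyclotomic_ints_add[of a k "-b"] cyclotomic_ints_uminus[of b k] by simp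

lemma cyclotomic_ints_mult_root:
  assumes "a \<in> cyclotomic_ints k" "z \<in> roots_of_unity k"
  shows "a * z \<in> cyclotomic_ints k"
  using assms
  by induction (auto simp: ring_distribs mult_roots_of_unity intro: cyclotomic_ints.intros)

lemma cyclotomic_ints_mult:
  assumes "a \<in> cyclotomic_ints k" "b \<in> cyclotomic_ints k"
  shows "a * b \<in> cyclotomic_ints k"
  using assms(2,1)
  by induction (auto simp: ring_distribs
      intro: cyclotomic_ints.zero cyclotomic_ints_add cyclotomic_ints_diff cyclotomic_ints_mult_root)

lemma cyclotomic_ints_one: "1 \<in> cyclotomic_ints k"
  using roots_of_unity_subset one_in_roots_of_unity by blast

lemma cyclotomic_ints_power: "a \<in> cyclotomic_ints k \<Longrightarrow> a ^ m \<in> cyclotomic_ints k"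
  by (induction m) (auto intro: cyclotomic_ints_one cyclotomic_ints_mult)

lemma cyclotomic_ints_of_nat: "of_nat m \<in> cyclotomic_ints k"
  by (induction m) (auto intro: cyclotomic_ints.zero cyclotomic_ints_one cyclotomic_ints_add)

lemma cyclotomic_ints_cnj: "a \<in> cyclotomic_ints k \<Longrightarrow> cnj a \<in> cyclotomic_ints k"
  by (induction rule: cyclotomic_ints.induct) (auto intro: cyclotomic_ints.intros cnj_roots_of_unity)

lemma cyclotomic_ints_sum:
  "(\<And>i. i \<in> I \<Longrightarrow> f i \<in> cyclotomic_ints k) \<Longrightarrow> sum f I \<in> cyclotomic_ints k"
  by (induction I rule: infinite_finite_induct) (auto intro: cyclotomic_ints.zero cyclotomic_ints_add)

section \<open>Integrality over the integers\<close>

lemma roots_of_unity_eq_powers: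
  assumes "k > 0"
  shows "roots_of_unity k = (\<lambda>j. cis (2 * pi / real k) ^ j) ` {..<k}"
proof -
  have "{z::complex. z ^ k = 1} = (\<lambda>j. cis (2 * pi * real j / real k)) ` {..<k}"
    using bij_betw_roots_unity[OF assms] by (auto simp: bij_betw_def)
  moreover have "cis (2 * pi * real j / real k) = cis (2 * pi / real k) ^ j" for j
    by (simp add: Complex.DeMoivre mult_ac)
  ultimately show ?thesis
    by (simp add: roots_of_unity_def)
qed

text \<open>Multiplication by a root of unity sends each power of \<open>\<zeta>\<close> to another
  such power, so it acts by a 0/1 matrix; sums and differences of roots act by sums and differences
  of these matrices. The powers are linearly dependent for \<open>k > 1\<close>, so \<open>C\<close>
  is a choice.\<close>

lemma cyclotomic_ints_integer_matrix:
  assumes "a \<in> cyclotomic_ints k" "k > 0"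
  defines "\<zeta> \<equiv> cis (2 * pi / real k)"
  shows "\<exists>C :: nat \<Rightarrow> nat \<Rightarrow> int. \<forall>i<k. a * \<zeta> ^ i = (\<Sum>j<k. of_int (C i j) * \<zeta> ^ j)"
  using assms(1)
proof induction
  case zero
  show ?case by (rule exI[of _ "\<lambda>_ _. 0"]) simp
next
  have roots: "\<exists>D :: nat \<Rightarrow> nat \<Rightarrow> int. \<forall>i<k. z * \<zeta> ^ i = (\<Sum>j<k. of_int (D i j) * \<zeta> ^ j)"
    if z: "z \<in> roots_of_unity k" for z
  proof -
    have "\<exists>m<k. z * \<zeta> ^ i = \<zeta> ^ m" for i
    proof -
      have "\<zeta> \<in> roots_of_unity k"
        using assms(2) by (simp add: \<zeta>_def roots_of_unity_def Complex.DeMoivre)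
      then have "z * \<zeta> ^ i \<in> roots_of_unity k"
        using z by (induction i) (auto simp: mult_roots_of_unity mult.left_commute)
      then show ?thesis
        using roots_of_unity_eq_powers[OF assms(2)] by (auto simp: \<zeta>_def)
    qed
    then obtain m where m: "\<And>i. m i < k" "\<And>i. z * \<zeta> ^ i = \<zeta> ^ m i"
      by metis
    \<comment> \<open>Row \<open>i\<close> is the unit vector at position
      \<open>m i\<close>.\<close>
    have "z * \<zeta> ^ i = (\<Sum>j<k. of_int (if j = m i then 1 else 0) * \<zeta> ^ j)" for i
      using m[of i] by (simp add: if_distrib[of of_int] if_distrib[of "\<lambda>c. c * _"] sum.delta cong: if_cong)
    then show ?thesis
      by (intro exI[of _ "\<lambda>i j. if j = m i then 1 else 0"]) blast
  qed
  {
    case (add_root a z)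
    then obtain C D where
      "\<forall>i<k. a * \<zeta> ^ i = (\<Sum>j<k. of_int (C i j) * \<zeta> ^ j)"
      "\<forall>i<k. z * \<zeta> ^ i = (\<Sum>j<k. of_int (D i j) * \<zeta> ^ j)"
      using roots by blast
    then show ?case
      by (intro exI[of _ "\<lambda>i j. C i j + D i j"]) (simp add: ring_distribs sum.distrib)
  next
    case (diff_root a z)
    then obtain C D where
      "\<forall>i<k. a * \<zeta> ^ i = (\<Sum>j<k. of_int (C i j) * \<zeta> ^ j)"
      "\<forall>i<k. z * \<zeta> ^ i = (\<Sum>j<k. of_int (D i j) * \<zeta> ^ j)"
      using roots by blast
    then show ?case
      by (intro exI[of _ "\<lambda>i j. C i j - D i j"]) (simp add: ring_distribs sum_subtractf)
  }
qed

lemma cyclotomic_ints_algebraic_int: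
  assumes "a \<in> cyclotomic_ints k" "k > 0"
  shows "algebraic_int a"
proof -
  \<comment> \<open>\<open>a\<close> is an eigenvalue of an integer matrix, with the powers of \<open>\<zeta>\<close> as eigenvector.\<close>
  define \<zeta> where "\<zeta> = cis (2 * pi / real k)"
  obtain C :: "nat \<Rightarrow> nat \<Rightarrow> int"
    where C: "\<And>i. i < k \<Longrightarrow> a * \<zeta> ^ i = (\<Sum>j<k. of_int (C i j) * \<zeta> ^ j)"
    using cyclotomic_ints_integer_matrix[OF assms] unfolding \<zeta>_def by blast
  define A where "A = mat k k (\<lambda>(i, j). C i j)"
  define B :: "complex mat" where "B = map_mat of_int A"
  define v where "v = vec k (\<lambda>i. \<zeta> ^ i)"
  have A: "A \<in> carrier_mat k k" and B: "B \<in> carrier_mat k k"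
    by (auto simp: A_def B_def)
  have "B *\<^sub>v v = a \<cdot>\<^sub>v v"
    by (rule eq_vecI)
       (auto simp: A_def B_def v_def C scalar_prod_def atLeast0LessThan)
  \<comment> \<open>The entry at index \<open>0\<close> is \<open>\<zeta> ^ 0 = 1\<close>, and
    \<open>k > 0\<close> makes this index valid.\<close>
  moreover have "v $ 0 \<noteq> 0\<^sub>v k $ 0"
    using assms(2) by (simp add: v_def)
  then have "v \<noteq> 0\<^sub>v k"
    by metis
  ultimately have "eigenvalue B a"
    using B by (auto simp: eigenvalue_def eigenvector_def v_def intro!: exI[of _ v])
  then have "poly (char_poly B) a = 0"
    using eigenvalue_root_char_poly[OF B] by simp
  moreover have "char_poly B = map_poly of_int (char_poly A)"
    unfolding B_def by (rule of_int_hom.char_poly_hom[OF A])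
  moreover have "lead_coeff (char_poly A) = 1"
    using degree_monic_char_poly[OF A] by simp
  ultimately show ?thesis
    by (auto simp: algebraic_int_altdef_ipoly)
qed

section \<open>Congruences and the Frobenius map modulo \<open>p\<close>\<close>

text \<open>Congruence modulo the ideal generated by \<open>m\<close>. The quotient \<open>r\<close>
  must lie in the ring: with arbitrary complex \<open>r\<close>, all numbers would be congruent for
  \<open>m > 0\<close>.\<close>

definition cyc_cong :: "nat \<Rightarrow> nat \<Rightarrow> complex \<Rightarrow> complex \<Rightarrow> bool" where
  "cyc_cong k m a b \<longleftrightarrow> (\<exists>r \<in> cyclotomic_ints k. a - b = of_nat m * r)"

lemma cyc_cong_refl: "cyc_cong k m a a"
  by (auto simp: cyc_cong_def intro: bexI[OF _ cyclotomic_ints.zero])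

lemma cyc_cong_sym:
  assumes "cyc_cong k m a b" shows "cyc_cong k m b a"
proof -
  obtain r where r: "r \<in> cyclotomic_ints k" "a - b = of_nat m * r"
    using assms by (auto simp: cyc_cong_def)
  then have "b - a = of_nat m * (- r)"
    by (simp add: algebra_simps)
  then show ?thesis
    unfolding cyc_cong_def using cyclotomic_ints_uminus[OF r(1)] by blast
qed

lemma cyc_cong_add:
  assumes "cyc_cong k m a b" "cyc_cong k m c d"
  shows "cyc_cong k m (a + c) (b + d)"
proof -
  obtain r s where r: "r \<in> cyclotomic_ints k" "a - b = of_nat m * r"
    and s: "s \<in> cyclotomic_ints k" "c - d = of_nat m * s"
    using assms by (auto simp: cyc_cong_def)
  then have "a + c - (b + d) = of_nat m * (r + s)"
    by (simp add: algebra_simps)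
  then show ?thesis
    using cyclotomic_ints_add[OF r(1) s(1)] by (auto simp: cyc_cong_def)
qed

lemma cyc_cong_trans [trans]:
  assumes "cyc_cong k m a b" "cyc_cong k m b c"
  shows "cyc_cong k m a c"
proof -
  \<comment> \<open>The two congruences are added and the common term \<open>b\<close>
    cancels.\<close>
  have "cyc_cong k m (a + b + (- b)) (b + c + (- b))"
    by (intro cyc_cong_add assms cyc_cong_refl)
  then show ?thesis by simp
qed

lemma cyc_cong_mult_right:
  assumes "cyc_cong k m a b" "c \<in> cyclotomic_ints k"
  shows "cyc_cong k m (a * c) (b * c)"
proof -
  obtain r where r: "r \<in> cyclotomic_ints k" "a - b = of_nat m * r"
    using assms(1) by (auto simp: cyc_cong_def)
  then have "a * c - b * c = of_nat m * (r * c)"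
    by (simp add: mult.assoc flip: left_diff_distrib)
  then show ?thesis
    using cyclotomic_ints_mult[OF r(1) assms(2)] by (auto simp: cyc_cong_def)
qed

lemma cyc_cong_power:
  assumes "cyc_cong k m a b" "a \<in> cyclotomic_ints k" "b \<in> cyclotomic_ints k"
  shows "cyc_cong k m (a ^ e) (b ^ e)"
proof (induction e)
  case (Suc e)
  have "cyc_cong k m (a * a ^ e) (b * a ^ e)"
    by (intro cyc_cong_mult_right cyclotomic_ints_power assms)
  also have "cyc_cong k m (b * a ^ e) (b * b ^ e)"
    using cyc_cong_mult_right[OF Suc assms(3)] by (simp add: mult.commute)
  finally show ?case by simp
qed (simp add: cyc_cong_refl)

text \<open>The inner binomial coefficients are divisible by the prime \<open>p\<close>; dividing
  them by \<open>p\<close> gives the ring element \<open>r\<close>.\<close>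

lemma cyc_cong_freshman:
  assumes "prime p" "a \<in> cyclotomic_ints k" "b \<in> cyclotomic_ints k"
  shows "cyc_cong k p ((a + b) ^ p) (a ^ p + b ^ p)"
proof -
  have p: "p > 0" using assms(1) by (rule prime_gt_0_nat)
  define r where "r = (\<Sum>i\<in>{1..<p}. of_nat ((p choose i) div p) * a ^ i * b ^ (p - i))"
  have "(a + b) ^ p = (\<Sum>i\<le>p. of_nat (p choose i) * a ^ i * b ^ (p - i))"
    by (rule binomial_ring)
  also have "{..p} = insert 0 (insert p {1..<p})"
    using p by auto
  also have "(\<Sum>i\<in>\<dots>. of_nat (p choose i) * a ^ i * b ^ (p - i)) =
      a ^ p + b ^ p + (\<Sum>i\<in>{1..<p}. of_nat (p choose i) * a ^ i * b ^ (p - i))"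
    using p by simp
  also have "(\<Sum>i\<in>{1..<p}. of_nat (p choose i) * a ^ i * b ^ (p - i)) = of_nat p * r"
    unfolding r_def sum_distrib_left
  proof (rule sum.cong)
    fix i assume i: "i \<in> {1..<p}"
    then have "p dvd p choose i"
      using assms(1) by (intro dvd_choose_prime) auto
    then have "p choose i = p * ((p choose i) div p)" by simp
    then have "(of_nat (p choose i) :: complex) = of_nat p * of_nat ((p choose i) div p)"
      by (metis of_nat_mult)
    then show "of_nat (p choose i) * a ^ i * b ^ (p - i) =
        of_nat p * (of_nat ((p choose i) div p) * a ^ i * b ^ (p - i))"
      by (simp add: mult.assoc)
  qed simp
  finally have "(a + b) ^ p - (a ^ p + b ^ p) = of_nat p * r" by simp
  moreover have "r \<in> cyclotomic_ints k"
    unfolding r_def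
    by (intro cyclotomic_ints_sum cyclotomic_ints_mult cyclotomic_ints_power
        cyclotomic_ints_of_nat assms)
  ultimately show ?thesis by (auto simp: cyc_cong_def)
qed

lemma cyc_cong_freshman_power:
  assumes "prime p" "a \<in> cyclotomic_ints k" "b \<in> cyclotomic_ints k"
  shows "cyc_cong k p ((a + b) ^ (p ^ j)) (a ^ (p ^ j) + b ^ (p ^ j))"
proof (induction j)
  case (Suc j)
  have "cyc_cong k p (((a + b) ^ (p ^ j)) ^ p) ((a ^ (p ^ j) + b ^ (p ^ j)) ^ p)"
    by (intro cyc_cong_power Suc cyclotomic_ints_power cyclotomic_ints_add assms)
  also have "cyc_cong k p \<dots> ((a ^ (p ^ j)) ^ p + (b ^ (p ^ j)) ^ p)"
    by (intro cyc_cong_freshman cyclotomic_ints_power assms)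
  finally show ?case
    by (simp add: mult.commute flip: power_mult)
qed (simp add: cyc_cong_refl)

lemma roots_of_unity_power_eq_cnj:
  assumes "z \<in> roots_of_unity k" "k > 0" "k dvd q + 1"
  shows "z ^ q = cnj z"
proof -
  obtain c where c: "q + 1 = k * c" using assms(3) by (rule dvdE)
  have "z ^ (q + 1) = 1"
    using assms(1) unfolding c power_mult by (simp add: roots_of_unity_def)
  have "z ^ q = z ^ q * (z * cnj z)"
    using roots_of_unity_mult_cnj[OF assms(1,2)] by simp
  also have "\<dots> = z ^ (q + 1) * cnj z" by (simp add: mult_ac)
  also have "\<dots> = cnj z" using \<open>z ^ (q + 1) = 1\<close> by simp
  finally show ?thesis .
qed

text \<open>Both sides are additive modulo \<open>p\<close>, and they agree on roots of unity, where
  conjugation is inversion.\<close>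

lemma cyc_cong_frobenius_cnj:
  assumes a: "a \<in> cyclotomic_ints k" and "k > 0" "prime p" "k dvd p ^ j + 1"
  shows "cyc_cong k p (a ^ (p ^ j)) (cnj a)"
  using a
proof induction
  case zero
  then show ?case using prime_gt_0_nat[OF assms(3)] by (simp add: cyc_cong_refl power_0_left)
next
  case (add_root a z)
  have "cyc_cong k p ((a + z) ^ (p ^ j)) (a ^ (p ^ j) + z ^ (p ^ j))"
    using add_root roots_of_unity_subset by (intro cyc_cong_freshman_power assms) auto
  also have "cyc_cong k p \<dots> (cnj a + cnj z)"
    using add_root roots_of_unity_power_eq_cnj[OF _ assms(2,4)]
    by (intro cyc_cong_add) (auto simp: cyc_cong_refl)
  finally show ?case by simp
next
  case (diff_root a z)
  \<comment> \<open>Writing \<open>a\<close> as \<open>(a - z) + z\<close> and solving for the power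
    of \<open>a - z\<close> avoids the sign of \<open>(- z) ^ (p ^ j)\<close>, which depends on the
    parity of \<open>p\<close>.\<close>
  have "cyc_cong k p ((a - z + z) ^ (p ^ j)) ((a - z) ^ (p ^ j) + z ^ (p ^ j))"
    using diff_root roots_of_unity_subset
    by (intro cyc_cong_freshman_power assms cyclotomic_ints.diff_root) auto
  then have "cyc_cong k p ((a - z) ^ (p ^ j) + cnj z) (a ^ (p ^ j))"
    using roots_of_unity_power_eq_cnj[OF diff_root.hyps(2) assms(2,4)] by (simp add: cyc_cong_sym)
  also have "cyc_cong k p \<dots> (cnj a)" by (rule diff_root.IH)
  finally have "cyc_cong k p ((a - z) ^ (p ^ j) + cnj z + (- cnj z)) (cnj a + (- cnj z))"
    by (intro cyc_cong_add cyc_cong_refl)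
  then show ?case by simp
qed

text \<open>Since \<open>a ^ (q\<^sup>2) \<equiv> a\<close> for \<open>q = p ^ j\<close>, nilpotent elements modulo \<open>p\<close> vanish; and
  \<open>a ^ (q + 1) \<equiv> a * cnj a\<close>.\<close>

lemma prime_dvd_of_dvd_norm:
  assumes a: "a \<in> cyclotomic_ints k" and k: "k > 0" and p: "prime p"
    and j: "j > 0" "k dvd p ^ j + 1" and norm: "a * cnj a = of_nat m" and "p dvd m"
  shows "\<exists>b \<in> cyclotomic_ints k. a = of_nat p * b"
proof -
  define q where "q = p ^ j"
  have "p \<ge> 2" using p by (rule prime_ge_2_nat)
  then have q: "q \<ge> 2"
    using j(1) self_le_power[of p j] unfolding q_def by linarith
  have frob: "cyc_cong k p (c ^ q) (cnj c)" if "c \<in> cyclotomic_ints k" for c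
    unfolding q_def by (rule cyc_cong_frobenius_cnj[OF that k p j(2)])
  have "cyc_cong k p (a ^ q * a) (cnj a * a)"
    by (intro cyc_cong_mult_right frob a)
  also have "cyc_cong k p (cnj a * a) 0"
  proof -
    obtain c where "m = p * c" using \<open>p dvd m\<close> by (rule dvdE)
    then have "cnj a * a - 0 = of_nat p * of_nat c"
      using norm by (simp add: mult.commute)
    then show ?thesis using cyclotomic_ints_of_nat by (auto simp: cyc_cong_def)
  qed
  finally have zero: "cyc_cong k p (a ^ (q + 1)) 0" by (simp add: mult.commute)
  \<comment> \<open>This fails for \<open>q = 1\<close>, which is why \<open>j > 0\<close> is
    required. It makes \<open>a ^ (q + 1)\<close> a factor of \<open>a ^ (q * q)\<close>.\<close>
  have "q + 1 \<le> q * q"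
    using q mult_le_mono1[OF q, of q] by linarith
  then have split: "a ^ (q * q) = a ^ (q + 1) * a ^ (q * q - (q + 1))"
    by (metis le_add_diff_inverse power_add)
  have "cyc_cong k p (a ^ (q + 1) * a ^ (q * q - (q + 1))) (0 * a ^ (q * q - (q + 1)))"
    by (intro cyc_cong_mult_right zero cyclotomic_ints_power a)
  then have nil: "cyc_cong k p (a ^ (q * q)) 0" by (simp add: split)
  \<comment> \<open>Two applications of Frobenius conjugate twice and so return to
    \<open>a\<close>.\<close>
  have "cyc_cong k p (a ^ (q * q)) (cnj a ^ q)"
    unfolding power_mult by (intro cyc_cong_power frob cyclotomic_ints_power cyclotomic_ints_cnj a)
  also have "cyc_cong k p (cnj a ^ q) (cnj (cnj a))"
    by (intro frob cyclotomic_ints_cnj a)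
  finally have "cyc_cong k p a (a ^ (q * q))" by (simp add: cyc_cong_sym)
  from this nil have "cyc_cong k p a 0" by (rule cyc_cong_trans)
  then show ?thesis by (auto simp: cyc_cong_def)
qed

section \<open>Descent on the norm\<close>

text \<open>If \<open>p\<close> divides \<open>m\<close>, then \<open>a = p * b\<close> and
  \<open>b\<close> has norm \<open>m / p ^ 2\<close>, whose multiplicity is smaller by two.
  Otherwise the multiplicity is zero.\<close>

lemma even_multiplicity_of_norm:
  assumes k: "k > 0" and p: "prime p" and j: "j > 0" "k dvd p ^ j + 1"
    and "a \<in> cyclotomic_ints k" "a * cnj a = of_nat m" "m > 0"
  shows "even (multiplicity p m)"
  using assms(5-)
proof (induction m arbitrary: a rule: less_induct)
  case (less m)
  show ?case
  proof (cases "p dvd m")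
    case True
    have p2: "p \<ge> 2" using p by (rule prime_ge_2_nat)
    obtain b where b: "b \<in> cyclotomic_ints k" "a = of_nat p * b"
      using prime_dvd_of_dvd_norm[OF less.prems(1) k p j less.prems(2) True] by blast
    have m: "of_nat p ^ 2 * (b * cnj b) = of_nat m"
      using less.prems(2) by (simp add: b(2) power2_eq_square mult_ac)
    have bb: "b * cnj b = of_nat m / of_nat (p ^ 2)"
      using m p2 by (simp add: field_simps)
    \<comment> \<open>A priori \<open>m / p ^ 2\<close> is only rational; as the norm of
      \<open>b\<close> it is also an algebraic integer, hence an integer.\<close>
    have "algebraic_int (b * cnj b)"
      by (intro cyclotomic_ints_algebraic_int[OF _ k] cyclotomic_ints_mult cyclotomic_ints_cnj b)
    moreover have "b * cnj b \<in> \<rat>"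
      unfolding bb by (intro Rats_divide) auto
    ultimately have "b * cnj b \<in> \<int>" by (rule rational_algebraic_int_is_int)
    then obtain i where i: "b * cnj b = of_int i" by (auto elim: Ints_cases)
    have "of_int (int p ^ 2 * i) = (of_int (int m) :: complex)"
      using m by (simp add: i)
    then have pi: "int p ^ 2 * i = int m" by (simp only: of_int_eq_iff)
    then have "i > 0"
      using less.prems(3) p2 zero_less_mult_pos[of "int p ^ 2" i] by simp
    then obtain m' where m': "i = int m'" "m' > 0"
      by (metis zero_less_imp_eq_int)
    have mm: "m = p ^ 2 * m'"
      using pi unfolding m' by (metis of_nat_eq_iff of_nat_mult of_nat_power)
    have "m' < m"
      using m'(2) one_less_power[of p 2] p2 unfolding mm by simp
    then have "even (multiplicity p m')"
      using less.IH[of m' b] b(1) i m' by simp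
    moreover have "multiplicity p m = 2 + multiplicity p m'"
      using p m'(2) p2 unfolding mm
      by (subst prime_elem_multiplicity_mult_distrib) (auto simp: multiplicity_same_power)
    ultimately show ?thesis by simp
  qed (simp add: not_dvd_imp_multiplicity_0)
qed

section \<open>Application to the entries of \<open>H x\<close>\<close>

lemma mult_mat_vec_in_cyclotomic_ints:
  assumes "H \<in> BH n k" "bent n k H x" "i < n"
  shows "(H *\<^sub>v x) $ i \<in> cyclotomic_ints k"
proof -
  have H: "H \<in> carrier_mat n n" "\<And>i j. i < n \<Longrightarrow> j < n \<Longrightarrow> H $$ (i, j) \<in> roots_of_unity k"
    using assms(1) by (auto simp: BH_def)
  have x: "x \<in> carrier_vec n" "\<And>i. i < n \<Longrightarrow> x $ i \<in> roots_of_unity k"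
    using assms(2) by (auto simp: bent_def)
  have "(H *\<^sub>v x) $ i = (\<Sum>j\<in>{0..<n}. H $$ (i, j) * x $ j)"
    using H(1) x(1) assms(3) by (simp add: scalar_prod_def)
  also have "\<dots> \<in> cyclotomic_ints k"
    using H(2) x(2) assms(3)
    by (intro cyclotomic_ints_sum cyclotomic_ints_mult_root subsetD[OF roots_of_unity_subset]) auto
  finally show ?thesis .
qed

lemma bent_norm:
  assumes "H \<in> BH n k" "bent n k H x" "i < n"
  shows "(H *\<^sub>v x) $ i * cnj ((H *\<^sub>v x) $ i) = of_nat n"
proof -
  obtain y where y: "y \<in> carrier_vec n" "cmod (y $ i) = 1"
    "H *\<^sub>v x = complex_of_real (sqrt (real n)) \<cdot>\<^sub>v y"
    using assms(2,3) by (auto simp: bent_def)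
  then have "cmod ((H *\<^sub>v x) $ i) = sqrt (real n)"
    using assms(3) by (simp add: norm_mult)
  then have "(H *\<^sub>v x) $ i * cnj ((H *\<^sub>v x) $ i) = complex_of_real (sqrt (real n) ^ 2)"
    by (metis complex_norm_square)
  then show ?thesis by simp
qed

text \<open>The exponent \<open>j = 0\<close>, which \<open>self_conjugate\<close> permits for \<open>k \<le> 2\<close>, would make the Frobenius
  argument void; it is shifted by a multiple of the order of \<open>p\<close>.\<close>

lemma self_conjugate_positive_exponent:
  assumes "k > 0" "prime p" "prime_part p k = 1" "self_conjugate p k"
  shows "\<exists>j>0. k dvd p ^ j + 1"
proof -
  have "multiplicity p k = 0"
    using assms(2,3) prime_gt_1_nat[OF assms(2)] by (simp add: prime_part_def)
  then have "\<not> p dvd k"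
    using assms(1,2) using not_dvd_imp_multiplicity_0[of p k] prime_multiplicity_gt_zero_iff[of p k] by auto
  then have euler: "[p ^ totient k = 1] (mod k)"
    using prime_imp_coprime[OF assms(2)] by (intro euler_theorem)
  \<comment> \<open>Since \<open>prime_part p k = 1\<close>, the modulus in
    \<open>self_conjugate\<close> is \<open>k\<close> itself.\<close>
  obtain i where "[int p ^ i = - 1] (mod int k)"
    using assms(3,4) by (auto simp: self_conjugate_def)
  then have "int k dvd int (p ^ i + 1)"
    by (simp add: cong_iff_dvd_diff add.commute)
  then have "[p ^ i + 1 = 0] (mod k)"
    by (simp only: cong_0_iff int_dvd_int_iff)
  moreover have "[p ^ i * p ^ totient k + 1 = p ^ i * 1 + 1] (mod k)"
    by (intro cong_add cong_mult euler cong_refl)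
  ultimately have "[p ^ (i + totient k) + 1 = 0] (mod k)"
    unfolding power_add mult_1_right by (rule cong_trans[rotated])
  then have "k dvd p ^ (i + totient k) + 1" by (simp add: cong_0_iff)
  \<comment> \<open>For \<open>k > 0\<close> the totient is positive, so the new exponent is
    positive even if \<open>i = 0\<close>.\<close>
  then show ?thesis
    using assms(1) by (intro exI[of _ "i + totient k"]) simp
qed

theorem theorem3p3:
  fixes k n p :: nat and H :: "complex mat" and x :: "complex vec"
  assumes "k > 0" and "n > 0" and "prime p"
    and "H \<in> BH n k"
    and "bent n k H x"
    and "prime_part p k = 1"
    and "prime_part p n > 1"
    and "self_conjugate p k"
  shows "is_square (prime_part p n)"
proof -
  obtain j where "j > 0" "k dvd p ^ j + 1"
    using self_conjugate_positive_exponent assms by blast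
  \<comment> \<open>One entry suffices: \<open>n > 0\<close> serves as the bound on the index
    \<open>0\<close>, and the descent is applied to that entry with \<open>m = n\<close>.\<close>
  then have "even (multiplicity p n)"
    using even_multiplicity_of_norm[OF assms(1,3)] assms(2)
      mult_mat_vec_in_cyclotomic_ints[OF assms(4,5,2)] bent_norm[OF assms(4,5,2)]
    by blast
  then obtain b where "multiplicity p n = b * 2"
    by (elim evenE) (simp add: mult.commute)
  then show ?thesis
    by (simp add: prime_part_def power_mult)
qed

end
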